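(* Let $s=\psi(y)$ be a characteristic Sturmian word, with directive word $y=y_1y_2\cdots$. Then $s$ has the property that for every $n\geq 0$ its palindromic prefix of order $n$ has maximal length among the palindromic prefixes of order $n$ of all characteristic Sturmian words (i.e. $|\psi(y_1\cdots y_n)|\geq|\psi(u_1\cdots u_n)|$ for every characteristic Sturmian word $\psi(u_1u_2\cdots)$) if and only if $s=f$ or $s=E(f)$.
   Context: Let $\mathcal{A}=\{a,b\}$. For $w\in\mathcal{A}^*$, $w^{(+)}$ is the shortest palindrome having $w$ as a prefix; $\psi(\varepsilon)=\varepsilon$, $\psi(vx)=(\psi(v)x)^{(+)}$ ($v\in\mathcal{A}^*$, $x\in\mathcal{A}$). Since $\psi(y_1\cdots y_n)$ is a proper prefix of $\psi(y_1\cdots y_{n+1})$, $\psi$ extends to infinite words $y=y_1y_2\cdots$ by $\psi(y)=\lim_n\psi(y_1\cdots y_n)$; $y$ is called the directive word of $\psi(y)$. The characteristic Sturmian words are exactly the infinite words $\psi(y)$ where both letters $a$ and $b$ occur infinitely often in $y$. The palindromic prefix of order $n$ of $\psi(y)$ is $\psi(y_1\cdots y_n)$. The Fibonacci word is $f=\psi((ab)^\omega)$. $E$ is the morphism exchanging $a$ and $b$ (applied letterwise to infinite words). *)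

theory Defs
  imports "HOL-Library.Stream" "HOL-Library.Sublist"
begin

datatype letter = La | Lb

fun swap_letter :: "letter \<Rightarrow> letter" where
  "swap_letter La = Lb"
| "swap_letter Lb = La"

definition exchange :: "letter stream \<Rightarrow> letter stream" where
  "exchange = smap swap_letter"

definition palindrome :: "'a list \<Rightarrow> bool" where
  "palindrome w \<longleftrightarrow> rev w = w"

(* The minimiser is unique (lemma pal_closure_unique), so ARG_MIN makes no arbitrary choice. *)
definition pal_closure :: "'a list \<Rightarrow> 'a list" where
  "pal_closure w = (ARG_MIN length p. palindrome p \<and> prefix w p)"

(* foldl realises the recursion on the last letter; see psi_Nil and psi_snoc. *)
definition psi :: "letter list \<Rightarrow> letter list" where
  "psi w = foldl (\<lambda>u x. pal_closure (u @ [x])) [] w"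

(* Letters of streams are indexed from 0, so "stake n y" is y_1 ... y_n. *)
definition pal_prefix :: "letter stream \<Rightarrow> nat \<Rightarrow> letter list" where
  "pal_prefix y n = psi (stake n y)"

(* The limit of the increasing chain of words pal_prefix y n: the unique infinite
   word having all of them as prefixes (lemma psi_inf_ex1). *)
definition psi_inf :: "letter stream \<Rightarrow> letter stream" where
  "psi_inf y = (THE s. \<forall>n. \<exists>t. s = pal_prefix y n @- t)"

definition characteristic_sturmian :: "letter stream \<Rightarrow> bool" where
  "characteristic_sturmian s \<longleftrightarrow>
     (\<exists>y. s = psi_inf y \<and> (\<forall>x. infinite {i. y !! i = x}))"

definition fibonacci_word :: "letter stream" where
  "fibonacci_word = psi_inf (cycle [La, Lb])"

lemma pal_closure_props:
  shows palindrome_pal_closure: "palindrome (pal_closure w)"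
    and prefix_pal_closure: "prefix w (pal_closure w)"
    and length_pal_closure_le: "palindrome q \<Longrightarrow> prefix w q \<Longrightarrow> length (pal_closure w) \<le> length q"
proof -
  have "palindrome (w @ rev w) \<and> prefix w (w @ rev w)"
    by (simp add: palindrome_def)
  from arg_min_nat_lemma[of "\<lambda>p. palindrome p \<and> prefix w p", OF this, of length]
  show "palindrome (pal_closure w)" "prefix w (pal_closure w)"
    "palindrome q \<Longrightarrow> prefix w q \<Longrightarrow> length (pal_closure w) \<le> length q"
    unfolding pal_closure_def by auto
qed

lemma pal_closure_unique:
  assumes p: "palindrome p" "prefix w p"
    and min: "\<And>q. palindrome q \<Longrightarrow> prefix w q \<Longrightarrow> length p \<le> length q"
  shows "p = pal_closure w"
proof -
  let ?c = "pal_closure w"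
  note c = palindrome_pal_closure[of w] prefix_pal_closure[of w]
  have len: "length p = length ?c"
    using min[OF c] length_pal_closure_le[OF p] by simp
  define k where "k = length w"
  have short: "length p \<le> 2 * k"
  proof -
    have "palindrome (w @ rev w)" by (simp add: palindrome_def)
    from min[OF this] show ?thesis by (simp add: k_def)
  qed
  have nth_rev: "r ! i = r ! (length r - Suc i)" if "palindrome r" "i < length r" for r :: "'a list" and i
    using rev_nth[OF that(2)] that(1)[unfolded palindrome_def] by (simp only:)
  have fst: "r ! i = w ! i" if "prefix w r" "i < k" for r i
    using that by (auto simp: prefix_def nth_append k_def)
  show ?thesis
  proof (rule nth_equalityI[OF len])
    fix i assume i: "i < length p"
    show "p ! i = ?c ! i"
    proof (cases "i < k")
      case True
      then show ?thesis by (simp only: fst[OF p(2)] fst[OF c(2)])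
    next
      case False
      then have j: "length p - Suc i < k" using short i by linarith
      have "p ! i = w ! (length p - Suc i)"
        by (rule trans[OF nth_rev[OF p(1) i] fst[OF p(2) j]])
      moreover have "?c ! i = w ! (length p - Suc i)"
        by (rule trans[OF nth_rev[OF c(1) i[unfolded len]] fst[OF c(2) j, unfolded len], folded len])
      ultimately show ?thesis by simp
    qed
  qed
qed

lemma psi_Nil: "psi [] = []"
  by (simp add: psi_def)

lemma psi_snoc: "psi (v @ [x]) = pal_closure (psi v @ [x])"
  by (simp add: psi_def)

lemma pal_prefix_Suc: "pal_prefix y (Suc n) = pal_closure (pal_prefix y n @ [y !! n])"
proof -
  have "stake (Suc n) y = stake n y @ [y !! n]" by (rule stake_Suc)
  then show ?thesis by (simp only: pal_prefix_def psi_snoc)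
qed

lemma strict_prefix_pal_prefix: "strict_prefix (pal_prefix y n) (pal_prefix y (Suc n))"
  using prefix_pal_closure[of "pal_prefix y n @ [y !! n]"]
  unfolding pal_prefix_Suc prefix_def by (metis append_Cons append_Nil append_assoc strict_prefixI')

lemma prefix_pal_prefix: "m \<le> n \<Longrightarrow> prefix (pal_prefix y m) (pal_prefix y n)"
proof (induction n rule: dec_induct)
  case (step n)
  with strict_prefix_pal_prefix[of y n] show ?case
    unfolding strict_prefix_def using prefix_order.trans by blast
qed simp

lemma length_pal_prefix_ge: "n \<le> length (pal_prefix y n)"
proof (induction n)
  case (Suc n)
  then show ?case
    using prefix_length_less[OF strict_prefix_pal_prefix[of y n]] by simp
qed simp

lemma psi_inf_ex1: "\<exists>!s. \<forall>n. \<exists>t. s = pal_prefix y n @- t"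
proof (rule ex_ex1I)
  let ?P = "pal_prefix y"
  define s where "s = smap (\<lambda>i. ?P (Suc i) ! i) (fromN 0)"
  have "s = ?P n @- sdrop (length (?P n)) s" for n
  proof -
    have "stake (length (?P n)) s = ?P n"
    proof (rule nth_equalityI)
      fix i assume "i < length (stake (length (?P n)) s)"
      then have i: "i < length (?P n)" by simp
      have i': "i < length (?P (Suc i))" using length_pal_prefix_ge[of "Suc i" y] by simp
      have "?P (Suc i) ! i = ?P n ! i"
      proof (cases "Suc i \<le> n")
        case True
        from prefix_pal_prefix[OF this, of y] i' show ?thesis by (auto simp: prefix_def nth_append)
      next
        case False
        then have "n \<le> Suc i" by simp
        from prefix_pal_prefix[OF this, of y] i show ?thesis by (auto simp: prefix_def nth_append)
      qed
      then show "stake (length (?P n)) s ! i = ?P n ! i" using i by (simp add: s_def)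
    qed simp
    from stake_sdrop[of "length (?P n)" s, unfolded this] show ?thesis by (rule sym)
  qed
  then show "\<exists>s. \<forall>n. \<exists>t. s = ?P n @- t" by blast
next
  let ?P = "pal_prefix y"
  fix s s' :: "letter stream"
  assume s: "\<forall>n. \<exists>t. s = ?P n @- t" and s': "\<forall>n. \<exists>t. s' = ?P n @- t"
  have eq: "r !! i = ?P (Suc i) ! i" if r: "\<forall>n. \<exists>t. r = ?P n @- t" for r i
  proof -
    have "i < length (?P (Suc i))" using length_pal_prefix_ge[of "Suc i" y] by simp
    moreover obtain t where "r = ?P (Suc i) @- t" using r by blast
    ultimately show ?thesis by simp
  qed
  have "(!!) s = (!!) s'" using eq[OF s] eq[OF s'] by (intro ext) simp
  then show "s = s'" using stream_smap_nats[of s] stream_smap_nats[of s'] by simp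
qed

lemma psi_inf_prefix: "\<exists>t. psi_inf y = pal_prefix y n @- t"
  using theI'[OF psi_inf_ex1[of y]] unfolding psi_inf_def by blast

end

(*
  Put K n = length (pal_prefix y n) + 2, and for a letter x let L x n be K m for the last
  m < n with y !! m = x, or 1 if there is no such m.  The palindromic prefixes of pal_prefix y n
  are the pal_prefix y m with m <= n, which determines the longest palindromic suffix of
  pal_prefix y n @ [x] and gives K (n + 1) = 2 K n - L (y !! n) n.  By induction
  L a n + L b n = K n, so K (n + 2) <= K (n + 1) + K n, with equality exactly if the letters
  y !! n and y !! (n + 1) differ.  Hence the maximal lengths are the Fibonacci numbers minus 2, and
  they are attained exactly by the two alternating directive words.
*)
theory Submission
  imports Defs
begin

section \<open>Palindromic closure\<close>

text \<open>With \<open>w = p @ x # r\<close> and, by reversal, \<open>w = rev r @ x # p\<close>,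
  overlapping two copies of \<open>w\<close> in \<open>p\<close> gives the palindrome
  \<open>rev r @ x # p @ x # r\<close>, which extends \<open>w @ [x]\<close>.\<close>

lemma length_pal_closure_le_if:
  assumes "palindrome w" "palindrome p" "prefix (p @ [x]) w"
  shows "length (pal_closure (w @ [x])) + length p \<le> 2 * length w"
proof -
  obtain r where w: "w = p @ x # r"
    using assms(3) by (auto simp: prefix_def)
  have "w = rev w" using assms(1) by (simp add: palindrome_def)
  also have "\<dots> = rev r @ x # p" using assms(2) by (simp add: w palindrome_def)
  finally have w': "w = rev r @ x # p" .
  have "palindrome (rev r @ x # p @ x # r)" using assms(2) by (simp add: palindrome_def)
  moreover have "prefix (w @ [x]) (rev r @ x # p @ x # r)" by (simp add: w')
  ultimately have "length (pal_closure (w @ [x])) \<le> length (rev r @ x # p @ x # r)"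
    by (rule length_pal_closure_le)
  then show ?thesis by (simp add: w)
qed

text \<open>The closure either mirrors \<open>w\<close> at the new letter or is centred on a
  palindrome \<open>p\<close> such that \<open>x # p @ [x]\<close> is a suffix of
  \<open>w @ [x]\<close>. As \<open>w\<close> is a palindrome, such a \<open>p\<close> is also a
  prefix of \<open>w\<close> followed by \<open>x\<close>.\<close>

lemma length_pal_closure_cases:
  assumes "palindrome w"
  obtains "length (pal_closure (w @ [x])) = 2 * length w + 1"
  | p where "palindrome p" "prefix (p @ [x]) w"
      "length (pal_closure (w @ [x])) + length p = 2 * length w"
proof -
  let ?c = "pal_closure (w @ [x])"
  obtain t where c: "?c = w @ x # t"
    using prefix_pal_closure[of "w @ [x]"] by (auto simp: prefix_def)
  have "palindrome (w @ x # w)" "prefix (w @ [x]) (w @ x # w)"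
    using assms by (simp_all add: palindrome_def)
  then have "length ?c \<le> length (w @ x # w)" by (rule length_pal_closure_le)
  then have "length t \<le> length w" by (simp add: c)
  then consider "length t = length w" | "length t < length w" by linarith
  then show thesis
  proof cases
    case 1
    then show ?thesis by (intro that(1)) (simp add: c)
  next
    case 2
    have eq: "rev t @ x # w = w @ x # t"
      using palindrome_pal_closure[of "w @ [x]"] assms by (simp add: c palindrome_def)
    \<comment> \<open>Since \<open>t\<close> is shorter than \<open>w\<close>, the first
      \<open>Suc (length t)\<close> letters of the right-hand side lie inside
      \<open>w\<close>.\<close>
    from arg_cong[OF this, of "take (Suc (length t))"] 2
    have "take (Suc (length t)) w = rev t @ [x]" by simp
    then obtain p where w: "w = rev t @ x # p"
      by (metis append_Cons append_Nil append_assoc append_take_drop_id)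
    from eq have "w = p @ x # t" by (simp add: w)
    moreover from this have "w = rev t @ x # rev p" using assms by (auto simp: palindrome_def)
    ultimately have w': "w = p @ x # t" "rev p = p"
      using w by (simp, metis append_same_eq list.inject same_append_eq)
    have "palindrome p" "prefix (p @ [x]) w" using w' by (simp_all add: palindrome_def)
    moreover have "length ?c + length p = 2 * length w" unfolding c by (simp add: w'(1))
    ultimately show ?thesis by (rule that(2))
  qed
qed

text \<open>An involution carries every competing palindrome back to one extending \<open>w\<close>,
  so minimality transfers.\<close>

lemma pal_closure_map:
  assumes "\<And>x. f (f x) = x"
  shows "pal_closure (map f w) = map f (pal_closure w)"
proof (rule sym, rule pal_closure_unique)
  show "palindrome (map f (pal_closure w))"
    using palindrome_pal_closure[of w] by (simp add: palindrome_def rev_map)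
  show "prefix (map f w) (map f (pal_closure w))"
    by (intro map_mono_prefix prefix_pal_closure)
next
  fix q assume q: "palindrome q" "prefix (map f w) q"
  have "map f (map f w) = w" using assms by (simp add: o_def)
  then have "prefix w (map f q)" using map_mono_prefix[OF q(2), of f] by simp
  moreover have "palindrome (map f q)" using q(1) by (simp add: palindrome_def rev_map)
  ultimately show "length (map f (pal_closure w)) \<le> length q"
    using length_pal_closure_le[of "map f q" w] by simp
qed

section \<open>Palindromic prefixes and directive words\<close>

lemma palindrome_pal_prefix: "palindrome (pal_prefix y n)"
proof (cases n)
  case 0
  then show ?thesis by (simp add: pal_prefix_def psi_Nil palindrome_def)
next
  case (Suc m)
  then show ?thesis by (simp only: pal_prefix_Suc palindrome_pal_closure)
qed

lemma prefix_pal_prefix_snoc: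
  assumes "m < n"
  shows "prefix (pal_prefix y m @ [y !! m]) (pal_prefix y n)"
  using prefix_pal_closure[of "pal_prefix y m @ [y !! m]"] prefix_pal_prefix[of "Suc m" n y] assms
  unfolding pal_prefix_Suc by (meson Suc_leI prefix_order.trans)

text \<open>A palindromic prefix longer than \<open>pal_prefix y n\<close> also contains the next
  letter \<open>y !! n\<close>, so minimality of the closure forces it to reach
  \<open>pal_prefix y (Suc n)\<close>.\<close>

lemma palindromic_prefix_of_pal_prefix:
  assumes "palindrome p" "prefix p (pal_prefix y n)"
  shows "\<exists>m\<le>n. p = pal_prefix y m"
  using assms(2)
proof (induction n)
  case 0
  then show ?case by (auto simp: pal_prefix_def psi_Nil)
next
  case (Suc n)
  let ?v = "pal_prefix y n"
  have v: "prefix (?v @ [y !! n]) (pal_prefix y (Suc n))"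
    by (simp add: prefix_pal_prefix_snoc)
  show ?case
  proof (cases "length p \<le> length ?v")
    case True
    with Suc.prems append_prefixD[OF v] have "prefix p ?v"
      by (rule prefix_length_prefix)
    from Suc.IH[OF this] show ?thesis using le_SucI by blast
  next
    case False
    then have "prefix (?v @ [y !! n]) p"
      using Suc.prems by (intro prefix_length_prefix[OF v]) auto
    then have "length (pal_prefix y (Suc n)) \<le> length p"
      unfolding pal_prefix_Suc by (intro length_pal_closure_le assms(1))
    then have "p = pal_prefix y (Suc n)"
      using Suc.prems by (auto simp: prefix_def)
    then show ?thesis by blast
  qed
qed

text \<open>Identifies the candidates for \<open>p\<close> in
  \<open>length_pal_closure_cases\<close>: they come from the earlier occurrences of
  \<open>x\<close> in the directive word.\<close>

lemma palindromic_prefix_snoc_of_pal_prefix: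
  assumes "palindrome p" "prefix (p @ [x]) (pal_prefix y n)"
  obtains m where "m < n" "p = pal_prefix y m" "y !! m = x"
proof -
  obtain m where m: "m \<le> n" "p = pal_prefix y m"
    using palindromic_prefix_of_pal_prefix assms append_prefixD by metis
  have "length p < length (pal_prefix y n)"
    using prefix_length_le[OF assms(2)] by simp
  with m have "m < n" by (auto simp: le_less)
  from prefix_pal_prefix_snoc[OF this, of y] assms(2) have "y !! m = x"
    by (auto simp: m(2) prefix_def)
  with m \<open>m < n\<close> that show thesis by blast
qed

lemma psi_inf_eqI:
  assumes "\<And>n. \<exists>t. s = pal_prefix y n @- t"
  shows "psi_inf y = s"
  unfolding psi_inf_def using psi_inf_ex1 assms by (intro the1_equality) auto

lemma psi_inf_snth_length: "psi_inf y !! length (pal_prefix y n) = y !! n"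
proof -
  obtain t where "psi_inf y = pal_prefix y (Suc n) @- t" using psi_inf_prefix by blast
  moreover obtain r where "pal_prefix y (Suc n) = (pal_prefix y n @ [y !! n]) @ r"
    using prefix_pal_prefix_snoc[of n "Suc n" y] by (auto simp: prefix_def)
  ultimately show ?thesis by simp
qed

lemma stream_eqI:
  assumes "\<And>n. s !! n = t !! n"
  shows "s = t"
proof -
  have "(!!) s = (!!) t" using assms by blast
  then show ?thesis using stream_smap_nats[of s] stream_smap_nats[of t] by simp
qed

text \<open>The directive word can be read off: \<open>y !! n\<close> is the letter that follows the
  palindromic prefix of order \<open>n\<close>.\<close>

lemma psi_inf_inject: "psi_inf y = psi_inf z \<longleftrightarrow> y = z"
proof
  assume eq: "psi_inf y = psi_inf z"
  have pre: "pal_prefix y n = pal_prefix z n" for n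
  proof (induction n)
    case (Suc n)
    then have "y !! n = z !! n"
      using psi_inf_snth_length[of y n] psi_inf_snth_length[of z n] eq by simp
    with Suc show ?case by (simp only: pal_prefix_Suc)
  qed (simp add: pal_prefix_def)
  show "y = z"
    using psi_inf_snth_length[of y] psi_inf_snth_length[of z] eq pre by (intro stream_eqI) metis
qed simp

lemma swap_letter_swap_letter: "swap_letter (swap_letter x) = x"
  by (cases x) simp_all

lemma swap_letter_neq: "swap_letter x \<noteq> x"
  by (cases x) simp_all

lemma eq_swap_letter_iff: "x = swap_letter z \<longleftrightarrow> x \<noteq> z"
  by (cases x; cases z) simp_all

lemma pal_prefix_exchange: "pal_prefix (exchange y) n = map swap_letter (pal_prefix y n)"
proof (induction n)
  case (Suc n)
  have "exchange y !! n = swap_letter (y !! n)" by (simp add: exchange_def)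
  then show ?case
    unfolding pal_prefix_Suc Suc
    using pal_closure_map[of swap_letter "pal_prefix y n @ [y !! n]", OF swap_letter_swap_letter]
    by simp
qed (simp add: pal_prefix_def psi_Nil)

lemma psi_inf_exchange: "psi_inf (exchange y) = exchange (psi_inf y)"
proof (rule psi_inf_eqI)
  fix n
  obtain t where "psi_inf y = pal_prefix y n @- t" using psi_inf_prefix by blast
  then have "exchange (psi_inf y) = pal_prefix (exchange y) n @- smap swap_letter t"
    by (simp add: pal_prefix_exchange) (simp add: exchange_def)
  then show "\<exists>t. exchange (psi_inf y) = pal_prefix (exchange y) n @- t" by blast
qed

section \<open>Lengths of palindromic prefixes\<close>

text \<open>The shift by 2 makes the length of a central word the sum of its two coprime periods.\<close>

definition klen :: "letter stream \<Rightarrow> nat \<Rightarrow> nat" where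
  "klen y n = length (pal_prefix y n) + 2"

primrec last_klen :: "letter stream \<Rightarrow> letter \<Rightarrow> nat \<Rightarrow> nat" where
  "last_klen y x 0 = 1"
| "last_klen y x (Suc n) = (if y !! n = x then klen y n else last_klen y x n)"

lemma last_klen_pos: "0 < last_klen y x n"
  by (induction n) (auto simp: klen_def)

lemma last_klen_cases:
  obtains "last_klen y x n = 1" "\<And>m. m < n \<Longrightarrow> y !! m \<noteq> x"
  | m where "m < n" "y !! m = x" "last_klen y x n = klen y m"
      "\<And>k. k < n \<Longrightarrow> y !! k = x \<Longrightarrow> k \<le> m"
proof (induction n arbitrary: thesis)
  case 0
  then show ?case by simp
next
  case (Suc n)
  show ?case
  proof (cases "y !! n = x")
    case True
    then show ?thesis by (intro Suc.prems(2)[of n]) auto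
  next
    case False
    show ?thesis
    proof (rule Suc.IH)
      assume "last_klen y x n = 1" "\<And>m. m < n \<Longrightarrow> y !! m \<noteq> x"
      with False show thesis by (intro Suc.prems(1)) (auto simp: less_Suc_eq)
    next
      fix m
      assume "m < n" "y !! m = x" "last_klen y x n = klen y m"
        "\<And>k. k < n \<Longrightarrow> y !! k = x \<Longrightarrow> k \<le> m"
      with False show thesis by (intro Suc.prems(2)[of m]) (auto simp: less_Suc_eq)
    qed
  qed
qed

text \<open>A longer central palindrome gives a shorter closure, and the longest candidate belongs
  to the last earlier occurrence of \<open>y !! n\<close>.\<close>

lemma klen_Suc_add_last_klen: "klen y (Suc n) + last_klen y (y !! n) n = 2 * klen y n"
proof -
  let ?x = "y !! n"
  let ?w = "pal_prefix y n"
  let ?c = "pal_closure (?w @ [?x])"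
  have c: "klen y (Suc n) = length ?c + 2" by (simp only: klen_def pal_prefix_Suc)
  show ?thesis
  proof (rule last_klen_cases[of y ?x n])
    assume one: "last_klen y ?x n = 1" and none: "\<And>m. m < n \<Longrightarrow> y !! m \<noteq> ?x"
    have "length ?c = 2 * length ?w + 1"
    proof (rule length_pal_closure_cases[OF palindrome_pal_prefix[of y n], of ?x])
      fix p assume "palindrome p" "prefix (p @ [?x]) ?w"
      then obtain m where "m < n" "y !! m = ?x"
        by (rule palindromic_prefix_snoc_of_pal_prefix)
      with none show ?thesis by blast
    qed
    then show ?thesis unfolding c one by (simp add: klen_def)
  next
    fix m
    assume m: "m < n" "y !! m = ?x" "last_klen y ?x n = klen y m"
      and last: "\<And>k. k < n \<Longrightarrow> y !! k = ?x \<Longrightarrow> k \<le> m"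
    have "prefix (pal_prefix y m @ [?x]) ?w" using prefix_pal_prefix_snoc[OF m(1), of y] m(2) by simp
    then have le: "length ?c + length (pal_prefix y m) \<le> 2 * length ?w"
      by (intro length_pal_closure_le_if palindrome_pal_prefix)
    \<comment> \<open>Whichever \<open>p\<close> the closure is centred on, its order is at most
      \<open>m\<close>; the mirrored case is long enough anyway.\<close>
    have "2 * length ?w \<le> length ?c + length (pal_prefix y m)"
    proof (rule length_pal_closure_cases[OF palindrome_pal_prefix[of y n], of ?x])
      fix p
      assume "palindrome p" "prefix (p @ [?x]) ?w" and len: "length ?c + length p = 2 * length ?w"
      then obtain k where "k < n" "p = pal_prefix y k" "y !! k = ?x"
        using palindromic_prefix_snoc_of_pal_prefix by blast
      with last have "prefix p (pal_prefix y m)" by (simp add: prefix_pal_prefix)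
      from prefix_length_le[OF this] len show ?thesis by linarith
    qed simp
    with le show ?thesis unfolding c m(3) by (simp add: klen_def)
  qed
qed

text \<open>In step \<open>n\<close> only the value of the letter \<open>y !! n\<close> changes: it
  becomes \<open>klen y n\<close>, and the sum grows exactly as the recurrence prescribes.\<close>

lemma last_klen_add: "last_klen y x n + last_klen y (swap_letter x) n = klen y n"
proof (induction n)
  case 0
  then show ?case by (simp add: klen_def pal_prefix_def psi_Nil)
next
  case (Suc n)
  consider "y !! n = x" | "y !! n = swap_letter x"
    using eq_swap_letter_iff by blast
  then show ?case
    using Suc klen_Suc_add_last_klen[of y n]
    by cases (simp_all add: swap_letter_neq swap_letter_neq[symmetric])
qed

lemma klen_Suc: "klen y (Suc n) = klen y n + last_klen y (swap_letter (y !! n)) n"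
  using klen_Suc_add_last_klen[of y n] last_klen_add[of y "y !! n" n] by linarith

lemma klen_0: "klen y 0 = 2"
  by (simp add: klen_def pal_prefix_def psi_Nil)

lemma klen_1: "klen y (Suc 0) = 3"
  using klen_Suc[of y 0] by (simp add: klen_0)

lemma klen_Suc_Suc_alternating:
  assumes "y !! Suc n \<noteq> y !! n"
  shows "klen y (Suc (Suc n)) = klen y (Suc n) + klen y n"
proof -
  have "swap_letter (y !! Suc n) = y !! n"
    using assms eq_swap_letter_iff swap_letter_swap_letter by metis
  then show ?thesis using klen_Suc[of y "Suc n"] by (simp del: snth.simps)
qed

text \<open>After a repeated letter the increment is the unchanged value of the other letter, which
  is less than \<open>klen y n\<close> because both values are positive.\<close>

lemma klen_Suc_Suc_repeating:
  assumes "y !! Suc n = y !! n"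
  shows "klen y (Suc (Suc n)) < klen y (Suc n) + klen y n"
proof -
  have "last_klen y (swap_letter (y !! n)) n < klen y n"
    using last_klen_add[of y "y !! n" n] last_klen_pos[of y "y !! n" n] by linarith
  then show ?thesis
    using klen_Suc[of y "Suc n"] assms swap_letter_neq[of "y !! n"]
    by (simp del: snth.simps)
qed

lemma klen_Suc_Suc_le: "klen y (Suc (Suc n)) \<le> klen y (Suc n) + klen y n"
  using klen_Suc_Suc_alternating[of y n] klen_Suc_Suc_repeating[of y n] by fastforce

section \<open>Alternating directive words\<close>

definition alternating :: "letter stream \<Rightarrow> bool" where
  "alternating y \<longleftrightarrow> (\<forall>n. y !! Suc n \<noteq> y !! n)"

lemma klen_le_alternating:
  assumes "alternating z"
  shows "klen y n \<le> klen z n"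
proof -
  \<comment> \<open>The Fibonacci recurrence looks back two steps, so two consecutive bounds are
    carried along.\<close>
  have "klen y n \<le> klen z n \<and> klen y (Suc n) \<le> klen z (Suc n)"
  proof (induction n)
    case 0
    then show ?case by (simp add: klen_0 klen_1)
  next
    case (Suc n)
    then show ?case
      using klen_Suc_Suc_le[of y n] klen_Suc_Suc_alternating[of z n] assms
      by (auto simp: alternating_def)
  qed
  then show ?thesis by blast
qed

text \<open>At a repeated letter \<open>klen y\<close> would fall strictly short of the Fibonacci
  recurrence that \<open>klen z\<close> satisfies.\<close>

lemma alternating_if_klen_eq:
  assumes "alternating z" "\<And>n. klen y n = klen z n"
  shows "alternating y"
  unfolding alternating_def
  using assms klen_Suc_Suc_alternating[of z] klen_Suc_Suc_repeating[of y]
  by (metis alternating_def less_irrefl)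

lemma alternating_eqI:
  assumes "alternating y" "alternating z" "shd y = shd z"
  shows "y = z"
proof (rule stream_eqI)
  fix n show "y !! n = z !! n"
  proof (induction n)
    case (Suc n)
    have "y !! Suc n = swap_letter (y !! n)" "z !! Suc n = swap_letter (z !! n)"
      using assms(1,2) unfolding alternating_def eq_swap_letter_iff by blast+
    with Suc show ?case by simp
  qed (simp add: assms(3))
qed

lemma alternating_exchange: "alternating y \<Longrightarrow> alternating (exchange y)"
  unfolding alternating_def exchange_def by (metis snth_smap swap_letter_swap_letter)

lemma alternating_cycle: "alternating (cycle [La, Lb])"
proof -
  let ?c = "cycle [La, Lb]"
  have c: "?c = La ## Lb ## ?c" using cycle_decomp[of "[La, Lb]"] by simp
  have step: "?c !! Suc (Suc n) = ?c !! n" for n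
    using arg_cong[OF c, of "\<lambda>s. s !! Suc (Suc n)"] by (simp del: cycle.simps)
  have "?c !! Suc n \<noteq> ?c !! n" for n
  proof (induction n)
    case 0
    show ?case by simp
  next
    case (Suc n)
    then show ?case unfolding step by (rule not_sym)
  qed
  then show ?thesis by (simp add: alternating_def)
qed

lemma alternating_iff: "alternating y \<longleftrightarrow> y = cycle [La, Lb] \<or> y = exchange (cycle [La, Lb])"
proof
  assume y: "alternating y"
  show "y = cycle [La, Lb] \<or> y = exchange (cycle [La, Lb])"
  proof (cases "shd y")
    case La
    then show ?thesis using alternating_eqI[OF y alternating_cycle] by simp
  next
    case Lb
    then show ?thesis
      using alternating_eqI[OF y alternating_exchange[OF alternating_cycle]] by (simp add: exchange_def)
  qed
next
  assume "y = cycle [La, Lb] \<or> y = exchange (cycle [La, Lb])"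
  then show "alternating y" using alternating_cycle alternating_exchange by blast
qed

text \<open>Makes alternating directive words admissible competitors: each letter occurs in any two
  consecutive positions.\<close>

lemma characteristic_sturmian_alternating:
  assumes "alternating y"
  shows "characteristic_sturmian (psi_inf y)"
  unfolding characteristic_sturmian_def
proof (intro exI conjI allI)
  fix x
  have "\<exists>n\<ge>m. y !! n = x" for m
  proof (cases "y !! m = x")
    case False
    then have "y !! Suc m = x"
      using assms unfolding alternating_def by (metis eq_swap_letter_iff)
    then show ?thesis using le_SucI by blast
  qed blast
  then show "infinite {i. y !! i = x}"
    unfolding finite_nat_set_iff_bounded by (metis mem_Collect_eq not_less)
qed simp

theorem theorem4p4:
  fixes s y :: "letter stream"
  assumes "characteristic_sturmian s" and "s = psi_inf y"
  shows "(\<forall>n. \<forall>u. characteristic_sturmian (psi_inf u) \<longrightarrow>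
             length (pal_prefix y n) \<ge> length (pal_prefix u n))
         \<longleftrightarrow> s = fibonacci_word \<or> s = exchange fibonacci_word"
proof -
  let ?max = "\<forall>n. \<forall>u. characteristic_sturmian (psi_inf u) \<longrightarrow>
             length (pal_prefix y n) \<ge> length (pal_prefix u n)"
  have "?max \<longleftrightarrow> alternating y"
  proof
    assume ?max
    \<comment> \<open>The Fibonacci word alone suffices as competitor, since its lengths already
      bound all others.\<close>
    then have "klen (cycle [La, Lb]) n \<le> klen y n" for n
      using characteristic_sturmian_alternating[OF alternating_cycle] by (simp add: klen_def)
    then have "klen y n = klen (cycle [La, Lb]) n" for n
      using klen_le_alternating[OF alternating_cycle] by (simp add: order_antisym)
    then show "alternating y" by (rule alternating_if_klen_eq[OF alternating_cycle])
  next
    assume "alternating y"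
    then show ?max using klen_le_alternating[of y] by (simp add: klen_def)
  qed
  also have "\<dots> \<longleftrightarrow> s = fibonacci_word \<or> s = exchange fibonacci_word"
    unfolding alternating_iff fibonacci_word_def assms(2)
    by (simp only: psi_inf_exchange[symmetric] psi_inf_inject)
  finally show ?thesis .
qed

end
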